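(* Let $A$ be a dual ring and let $C\subseteq A$ be a non-zero ideal. Then $C$ is coprime if and only if $\operatorname{Ann}(C)$ is a prime ideal.
   Context: All rings are commutative with identity. For ideals $I,J$ of a ring $A$, $\operatorname{Ann}(I)=\{a\in A\mid aI=0\}$ and $(J:I)=\{a\in A\mid aI\subseteq J\}$. A ring $A$ is a dual ring if $\operatorname{Ann}(\operatorname{Ann}(I))=I$ for every ideal $I$ of $A$. The coproduct of $I$ and $J$ is the ideal $[I:J]:=(J:\operatorname{Ann}(I))=\{a\in A\mid a\operatorname{Ann}(I)\subseteq J\}$. An ideal $C$ of $A$ is coprime if $C\neq 0$ and, for all ideals $I,J$ of $A$, $C\subseteq [I:J]$ implies $C\subseteq I$ or $C\subseteq J$. *)

theory Defs
  imports "HOL-Algebra.Ideal"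
begin

definition annihilator :: "('a, 'm) ring_scheme \<Rightarrow> 'a set \<Rightarrow> 'a set" where
  "annihilator A I = {a \<in> carrier A. \<forall>x\<in>I. a \<otimes>\<^bsub>A\<^esub> x = \<zero>\<^bsub>A\<^esub>}"

(* The argument order is that of the notation (J : I). *)
definition ideal_quotient :: "('a, 'm) ring_scheme \<Rightarrow> 'a set \<Rightarrow> 'a set \<Rightarrow> 'a set" where
  "ideal_quotient A J I = {a \<in> carrier A. \<forall>x\<in>I. a \<otimes>\<^bsub>A\<^esub> x \<in> J}"

(* The coproduct [I : J] := (J : Ann(I)). *)
definition ideal_coproduct :: "('a, 'm) ring_scheme \<Rightarrow> 'a set \<Rightarrow> 'a set \<Rightarrow> 'a set" where
  "ideal_coproduct A I J = ideal_quotient A J (annihilator A I)"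

locale dual_ring = cring A for A (structure) +
  assumes annihilator_annihilator: "ideal I A \<Longrightarrow> annihilator A (annihilator A I) = I"

definition coprime_ideal :: "'a set \<Rightarrow> ('a, 'm) ring_scheme \<Rightarrow> bool" where
  "coprime_ideal C A \<longleftrightarrow> ideal C A \<and> C \<noteq> {\<zero>\<^bsub>A\<^esub>} \<and>
     (\<forall>I J. ideal I A \<longrightarrow> ideal J A \<longrightarrow> C \<subseteq> ideal_coproduct A I J \<longrightarrow> C \<subseteq> I \<or> C \<subseteq> J)"

end

theory Submission
  imports Defs
begin

text \<open>
  Multiplying \<open>C \<subseteq> [I : J]\<close> out and using \<open>J = Ann (Ann J)\<close>, the condition becomes
  \<open>Ann I \<cdot> Ann J \<subseteq> Ann C\<close>, while \<open>C \<subseteq> I\<close> is equivalent to \<open>Ann I \<subseteq> Ann C\<close>.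
  So coprimeness of \<open>C\<close> is primeness of \<open>Ann C\<close> tested on products of ideals \<open>Ann I\<close>, \<open>Ann J\<close>. To test it
  on a single product \<open>a b \<in> Ann C\<close>, it suffices to take \<open>I = Ann {a}\<close> and \<open>J = Ann {b}\<close>.
\<close>

lemma annihilator_antimono: "S \<subseteq> T \<Longrightarrow> annihilator A T \<subseteq> annihilator A S"
  by (auto simp: annihilator_def)

context cring
begin

text \<open>Stated for arbitrary subsets because it is applied to singletons \<open>{a}\<close> as
  well as to the ideal \<open>C\<close>.\<close>

lemma annihilator_ideal:
  assumes "S \<subseteq> carrier R"
  shows "ideal (annihilator R S) R"
proof (rule idealI)
  have S: "s \<in> carrier R" if "s \<in> S" for s
    using assms that by blast
  show "subgroup (annihilator R S) (add_monoid R)"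
  proof (rule add.subgroupI)
    show "annihilator R S \<subseteq> carrier R"
      by (auto simp: annihilator_def)
    have "\<zero> \<in> annihilator R S"
      by (simp add: annihilator_def S)
    then show "annihilator R S \<noteq> {}" by blast
  next
    fix a assume "a \<in> annihilator R S"
    then show "\<ominus> a \<in> annihilator R S"
      by (simp add: annihilator_def l_minus S)
  next
    fix a b assume "a \<in> annihilator R S" "b \<in> annihilator R S"
    then show "a \<oplus> b \<in> annihilator R S"
      by (simp add: annihilator_def l_distr S)
  qed
  fix a x
  assume a: "a \<in> annihilator R S" and x: "x \<in> carrier R"
  show "x \<otimes> a \<in> annihilator R S"
    using a x by (simp add: annihilator_def m_assoc S)
  then show "a \<otimes> x \<in> annihilator R S"
    using a x by (simp add: annihilator_def m_comm)
qed (rule ring_axioms)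

lemma coprime_imp_primeideal_annihilator:
  assumes "coprime_ideal C R"
  shows "primeideal (annihilator R C) R"
proof -
  from assms have C: "ideal C R" and nz: "C \<noteq> {\<zero>}"
    and coprime: "\<And>I J. ideal I R \<Longrightarrow> ideal J R \<Longrightarrow> C \<subseteq> ideal_coproduct R I J \<Longrightarrow> C \<subseteq> I \<or> C \<subseteq> J"
    by (auto simp: coprime_ideal_def)
  interpret C: ideal C R by (rule C)
  show ?thesis
  proof (rule primeidealI)
    show "ideal (annihilator R C) R"
      by (rule annihilator_ideal[OF C.a_subset])
    show "carrier R \<noteq> annihilator R C"
    proof
      assume "carrier R = annihilator R C"
      then have "\<one> \<in> annihilator R C" by auto
      then have "\<forall>c\<in>C. c = \<zero>"
        by (simp add: annihilator_def)
      with nz C.zero_closed show False by blast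
    qed
    fix a b
    assume a: "a \<in> carrier R" and b: "b \<in> carrier R" and ab: "a \<otimes> b \<in> annihilator R C"
    have "C \<subseteq> ideal_coproduct R (annihilator R {a}) (annihilator R {b})"
    proof
      fix c assume c: "c \<in> C"
      have "(a \<otimes> b) \<otimes> c = \<zero>"
        using ab c by (simp add: annihilator_def)
      then have cb: "c \<otimes> b \<in> annihilator R {a}"
        using a b c by (simp add: annihilator_def m_ac)
      \<comment> \<open>Since \<open>c \<otimes> b\<close> lies in \<open>annihilator R {a}\<close>,
        it is killed by \<open>x\<close>; reordering the factors, \<open>b\<close> kills
        \<open>c \<otimes> x\<close>.\<close>
      have "c \<otimes> x \<in> annihilator R {b}" if x: "x \<in> annihilator R (annihilator R {a})" for x
      proof -
        have "x \<in> carrier R" "x \<otimes> (c \<otimes> b) = \<zero>"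
          using x cb by (auto simp: annihilator_def)
        then show ?thesis
          using b c by (simp add: annihilator_def m_ac)
      qed
      then show "c \<in> ideal_coproduct R (annihilator R {a}) (annihilator R {b})"
        using c by (simp add: ideal_coproduct_def ideal_quotient_def)
    qed
    then have "C \<subseteq> annihilator R {a} \<or> C \<subseteq> annihilator R {b}"
      using a b by (intro coprime annihilator_ideal) auto
    \<comment> \<open>By commutativity, \<open>C \<subseteq> annihilator R {a}\<close> and
      \<open>a \<in> annihilator R C\<close> both say that \<open>a\<close> kills \<open>C\<close>;
      likewise for \<open>b\<close>.\<close>
    then show "a \<in> annihilator R C \<or> b \<in> annihilator R C"
      using a b by (auto simp: annihilator_def m_comm subset_iff)
  qed (rule cring_axioms)
qed

end

context dual_ring
begin

text \<open>Taking annihilators reverses inclusions. Doing so once more and collapsing the double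
  annihilators by duality recovers the original ideals.\<close>

lemma annihilator_subset_iff:
  assumes "ideal I A" and "ideal J A"
  shows "annihilator A I \<subseteq> annihilator A J \<longleftrightarrow> J \<subseteq> I"
  using annihilator_antimono annihilator_annihilator assms by metis

lemma primeideal_annihilator_imp_coprime:
  assumes C: "ideal C A" and nz: "C \<noteq> {\<zero>}" and prime: "primeideal (annihilator A C) A"
  shows "coprime_ideal C A"
  unfolding coprime_ideal_def
proof (intro conjI allI impI)
  fix I J
  assume I: "ideal I A" and J: "ideal J A" and sub: "C \<subseteq> ideal_coproduct A I J"
  show "C \<subseteq> I \<or> C \<subseteq> J"
  proof (rule ccontr)
    assume "\<not> (C \<subseteq> I \<or> C \<subseteq> J)"
    \<comment> \<open>By duality, \<open>C\<close> not lying in \<open>I\<close> means that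
      \<open>annihilator A I\<close> is not contained in \<open>annihilator A C\<close>, which
      yields \<open>a\<close>; in the same way \<open>J\<close> yields \<open>b\<close>.\<close>
    then obtain a b where a: "a \<in> annihilator A I" "a \<notin> annihilator A C"
      and b: "b \<in> annihilator A J" "b \<notin> annihilator A C"
      using annihilator_subset_iff[OF I C] annihilator_subset_iff[OF J C] by blast
    have carr: "a \<in> carrier A" "b \<in> carrier A"
      using a b by (auto simp: annihilator_def)
    have "(a \<otimes> b) \<otimes> c = \<zero>" if c: "c \<in> C" for c
    proof -
      \<comment> \<open>As an element of the coproduct, \<open>c\<close> multiplies
        \<open>annihilator A I\<close> into \<open>J\<close>, and \<open>b\<close> kills
        \<open>J\<close>.\<close>
      have "c \<in> carrier A" "c \<otimes> a \<in> J"
        using c sub a by (auto simp: ideal_coproduct_def ideal_quotient_def)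
      moreover from this have "b \<otimes> (c \<otimes> a) = \<zero>"
        using b by (simp add: annihilator_def)
      ultimately show ?thesis
        using carr by (simp add: m_ac)
    qed
    then have "a \<otimes> b \<in> annihilator A C"
      using carr by (simp add: annihilator_def)
    then show False
      using primeideal.I_prime[OF prime carr] a b by blast
  qed
qed (use C nz in auto)

end

theorem theorem2:
  fixes A :: "('a, 'm) ring_scheme" and C :: "'a set"
  assumes "dual_ring A"
    and "ideal C A"
    and "C \<noteq> {\<zero>\<^bsub>A\<^esub>}"
  shows "coprime_ideal C A \<longleftrightarrow> primeideal (annihilator A C) A"
proof -
  interpret dual_ring A by (rule assms(1))
  show ?thesis
    using coprime_imp_primeideal_annihilator primeideal_annihilator_imp_coprime assms(2,3) by blast
qed

end
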